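(* For all integers $r\ge d\ge 0$ we have $$ (1-2^{d-r})\,\beta_r(d) \le \sum_{j=0}^d \binom rj - 2^d. $$
   Context: Let $\mathbb{F}_2^r$ be the $r$-dimensional vector space over the two-element field, and let $0\le d\le r$ be an integer. A subset $B\subseteq\mathbb{F}_2^r$ is called $d$-non-blocking if for every $v\in\mathbb{F}_2^r$ there exists a linear subspace $L_v\le\mathbb{F}_2^r$ of codimension $d$ (that is, of dimension $r-d$) such that $(v+(L_v\setminus\{0\}))\cap B=\varnothing$. By $\beta_r(d)$ we denote the largest possible size of a $d$-non-blocking subset of $\mathbb{F}_2^r$. *)

theory Defs
  imports Complex_Main "HOL-Library.Z2" "HOL-Library.Function_Algebras"
begin

text \<open>
  The dimension r must range over all natural numbers (including 0), so the
  r-dimensional space over the two-element field \<^typ>\<open>bit\<close> is the set of those sequences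
  \<^typ>\<open>nat \<Rightarrow> bit\<close> that vanish from index r on. Addition and zero of sequences are the
  pointwise ones of \<^theory>\<open>HOL-Library.Function_Algebras\<close>.
\<close>

definition scale_F2 :: "bit \<Rightarrow> (nat \<Rightarrow> bit) \<Rightarrow> (nat \<Rightarrow> bit)" where
  "scale_F2 c x = (\<lambda>i. c * x i)"

interpretation F2: vector_space scale_F2
  by unfold_locales (simp_all add: scale_F2_def fun_eq_iff algebra_simps del: add_bit_eq_xor mult_bit_eq_and)

definition F2_space :: "nat \<Rightarrow> (nat \<Rightarrow> bit) set" where
  "F2_space r = {x. \<forall>i\<ge>r. x i = 0}"

definition codim_subspace :: "nat \<Rightarrow> nat \<Rightarrow> (nat \<Rightarrow> bit) set \<Rightarrow> bool" where
  "codim_subspace r d L \<longleftrightarrow> L \<subseteq> F2_space r \<and> F2.subspace L \<and> F2.dim L + d = r"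

definition non_blocking :: "nat \<Rightarrow> nat \<Rightarrow> (nat \<Rightarrow> bit) set \<Rightarrow> bool" where
  "non_blocking r d B \<longleftrightarrow> B \<subseteq> F2_space r \<and>
     (\<forall>v\<in>F2_space r. \<exists>L. codim_subspace r d L \<and> (\<lambda>x. v + x) ` (L - {0}) \<inter> B = {})"

definition beta :: "nat \<Rightarrow> nat \<Rightarrow> nat" where
  "beta r d = Max {card B |B. non_blocking r d B}"

text \<open>
  The next lemmas show that the maximum in \<^const>\<open>beta\<close> is taken over a finite, nonempty set
  whenever d \<open>\<le>\<close> r.
\<close>

lemma subspace_F2_space: "F2.subspace (F2_space r)"
  by (auto simp: F2.subspace_def F2_space_def scale_F2_def)

lemma finite_F2_space: "finite (F2_space r)"
proof -
  have "F2_space r \<subseteq> {x. \<forall>i. (i \<in> {..<r} \<longrightarrow> x i \<in> (UNIV :: bit set)) \<and> (i \<notin> {..<r} \<longrightarrow> x i = 0)}"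
    by (auto simp: F2_space_def)
  moreover have "finite (UNIV :: bit set)"
  proof -
    have "(UNIV :: bit set) = {0, 1}" using bit_not_one_iff by auto
    then show ?thesis by (metis finite.emptyI finite.insertI)
  qed
  ultimately show ?thesis
    using finite_set_of_finite_funs[of "{..<r}" "UNIV :: bit set" 0] finite_subset by blast
qed

lemma dim_F2_space: "F2.dim (F2_space r) = r"
proof -
  let ?e = "\<lambda>i j. if j = i then (1::bit) else 0"
  have inj: "inj_on ?e {..<r}" by (rule inj_onI) (metis zero_neq_one)
  have sumf: "(\<Sum>i<r. scale_F2 (u i) (?e i)) j = (if j < r then u j else 0)" for u j
    by (induction r) (auto simp: scale_F2_def less_Suc_eq)
  have ind: "F2.independent (?e ` {..<r})"
  proof (subst F2.independent_explicit_finite_subsets, intro allI impI ballI)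
    show "u x = 0" if A: "A \<subseteq> ?e ` {..<r}" and "finite A"
      and z: "(\<Sum>v\<in>A. scale_F2 (u v) v) = 0" and x: "x \<in> A" for A u x
    proof -
      define w where "w v = (if v \<in> A then u v else 0)" for v
      have "(\<Sum>v\<in>?e ` {..<r}. scale_F2 (w v) v) = (\<Sum>v\<in>A. scale_F2 (u v) v)"
        by (rule sum.mono_neutral_cong_right) (use A in \<open>auto simp: w_def\<close>)
      with z have "(\<Sum>i<r. scale_F2 (w (?e i)) (?e i)) = 0"
        by (simp add: sum.reindex[OF inj] o_def)
      moreover obtain i where i: "i < r" "x = ?e i" using x A by auto
      ultimately have "w (?e i) = 0" using sumf[of "\<lambda>i. w (?e i)" i] by simp
      then show ?thesis using i x by (simp add: w_def)
    qed
  qed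
  have sub: "?e ` {..<r} \<subseteq> F2_space r" by (auto simp: F2_space_def)
  have "F2_space r \<subseteq> F2.span (?e ` {..<r})"
  proof
    fix x assume "x \<in> F2_space r"
    then have "x = (\<Sum>i<r. scale_F2 (x i) (?e i))"
      unfolding fun_eq_iff sumf by (auto simp: F2_space_def)
    moreover have "(\<Sum>i<r. scale_F2 (x i) (?e i)) \<in> F2.span (?e ` {..<r})"
      by (intro F2.span_sum F2.span_scale F2.span_base) auto
    ultimately show "x \<in> F2.span (?e ` {..<r})" by simp
  qed
  then have "F2.dim (F2_space r) = card (?e ` {..<r})"
    using F2.dim_unique[OF sub _ ind refl] by blast
  then show ?thesis by (simp add: card_image[OF inj])
qed

lemma finite_non_blocking_sizes: "finite {card B |B. non_blocking r d B}"
proof -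
  have "{card B |B. non_blocking r d B} \<subseteq> card ` Pow (F2_space r)"
    by (auto simp: non_blocking_def)
  then show ?thesis using finite_F2_space finite_subset by blast
qed

lemma non_blocking_empty:
  assumes "d \<le> r"
  shows "non_blocking r d {}"
proof -
  have "F2_space (r - d) \<subseteq> F2_space r" by (auto simp: F2_space_def)
  then have "codim_subspace r d (F2_space (r - d))"
    using assms by (simp add: codim_subspace_def subspace_F2_space dim_F2_space)
  then show ?thesis by (auto simp: non_blocking_def)
qed

end

theory Submission imports Defs begin

text \<open>
  For each point v the indicator function f v of v + L v is a product of d affine functionals,
  hence a polynomial function of degree at most d. On a non-blocking set B the functions f v
  with v in B restrict to point indicators, while those with v outside B vanish identically.
  Therefore the f v with v in B together with a basis C of the span of the remaining ones are
  linearly independent, which gives |B| + |C| at most the number of monomials. Moreover the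
  supports of the members of C cover the complement of B, and each of them has 2 ^ (r - d)
  elements, which bounds |C| from below.
\<close>

declare add_bit_eq_xor [simp del] mult_bit_eq_and [simp del]

section \<open>Linear algebra of field-valued functions, and a counting bound\<close>

definition fun_scale :: "'a::field \<Rightarrow> ('x \<Rightarrow> 'a) \<Rightarrow> 'x \<Rightarrow> 'a" where
  "fun_scale c f = (\<lambda>x. c * f x)"

interpretation fun_vs: vector_space fun_scale
  by unfold_locales (simp_all add: fun_scale_def fun_eq_iff algebra_simps)

lemma fun_span_vanishes:
  assumes "f \<in> fun_vs.span S" and "\<And>g. g \<in> S \<Longrightarrow> g x = 0"
  shows "f x = 0"
  using assms(1)
proof (induction rule: fun_vs.span_induct_alt)
  case (step c g h)
  then show ?case using assms(2) by (simp add: fun_scale_def)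
qed simp

text \<open>Points of \<open>B\<close> are inserted one at a time: evaluation at the new point
  \<open>b\<close> kills \<open>C\<close> and all earlier functions but not \<open>f b\<close>, so
  \<open>f b\<close> lies outside their span. The cardinality claim records that no two of these
  functions coincide.\<close>

lemma independent_point_functions:
  fixes f :: "'x \<Rightarrow> 'x \<Rightarrow> 'a::field"
  assumes "finite B" and C: "fun_vs.independent C" "finite C"
    and diag: "\<And>v. v \<in> B \<Longrightarrow> f v v \<noteq> 0"
    and off: "\<And>v u. v \<in> B \<Longrightarrow> u \<in> B \<Longrightarrow> u \<noteq> v \<Longrightarrow> f v u = 0"
    and vanish: "\<And>g u. g \<in> C \<Longrightarrow> u \<in> B \<Longrightarrow> g u = 0"
  shows "fun_vs.independent (f ` B \<union> C) \<and> card (f ` B \<union> C) = card B + card C"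
  using \<open>finite B\<close> diag off vanish
proof (induction B)
  case empty
  then show ?case using C by simp
next
  case (insert b B)
  let ?S = "f ` B \<union> C"
  have IH: "fun_vs.independent ?S" "card ?S = card B + card C"
    using insert.IH insert.prems by blast+
  have "g b = 0" if "g \<in> ?S" for g
    using that insert.prems insert.hyps by auto
  then have notin: "f b \<notin> fun_vs.span ?S"
    using fun_span_vanishes[of "f b" ?S b] insert.prems(1)[of b] by blast
  then have "f b \<notin> ?S" using fun_vs.span_base[of "f b" ?S] by blast
  moreover have "f ` insert b B \<union> C = insert (f b) ?S" by simp
  moreover have "fun_vs.independent (insert (f b) ?S)"
    by (rule fun_vs.independent_insertI[OF notin IH(1)])
  moreover have "finite ?S" using insert.hyps C(2) by simp
  ultimately show ?case using IH(2) insert.hyps by (simp only: card_insert_disjoint) simp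
qed

text \<open>The dimension count \<open>card B + card C \<le> card M\<close> is multiplied by
  \<open>s\<close>, and \<open>card C * s\<close> is then replaced by its lower bound
  \<open>card (V - B)\<close>, which comes from covering \<open>V - B\<close> by supports.\<close>

lemma local_functions_bound:
  fixes f :: "'x \<Rightarrow> 'x \<Rightarrow> 'a::field"
  assumes V: "finite V" "B \<subseteq> V" and M: "finite M"
    and poly: "\<And>v. v \<in> V \<Longrightarrow> f v \<in> fun_vs.span M"
    and diag: "\<And>v. v \<in> V \<Longrightarrow> f v v \<noteq> 0"
    and off: "\<And>v u. v \<in> V \<Longrightarrow> u \<in> B \<Longrightarrow> u \<noteq> v \<Longrightarrow> f v u = 0"
    and supp: "\<And>v. v \<in> V \<Longrightarrow> card {x \<in> V. f v x \<noteq> 0} \<le> s"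
  shows "card B * s + card (V - B) \<le> card M * s"
proof -
  obtain C where C: "C \<subseteq> f ` (V - B)" "fun_vs.independent C" "f ` (V - B) \<subseteq> fun_vs.span C"
    by (rule fun_vs.maximal_independent_subset)
  have finC: "finite C" using C(1) V(1) by (meson finite_Diff finite_imageI finite_subset)
  have finB: "finite B" using V finite_subset by blast
  have "V - B \<subseteq> (\<Union>g\<in>C. {x \<in> V. g x \<noteq> 0})"
  proof
    fix v assume v: "v \<in> V - B"
    then have "f v \<in> fun_vs.span C" using C(3) by blast
    \<comment> \<open>If all of \<open>C\<close> vanished at \<open>v\<close>, so would
      \<open>f v\<close>, which lies in its span.\<close>
    then have "\<exists>g\<in>C. g v \<noteq> 0" using fun_span_vanishes diag v by (metis DiffD1)
    then show "v \<in> (\<Union>g\<in>C. {x \<in> V. g x \<noteq> 0})" using v by blast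
  qed
  then have "card (V - B) \<le> card (\<Union>g\<in>C. {x \<in> V. g x \<noteq> 0})"
    using V(1) finC by (intro card_mono) auto
  also have "\<dots> \<le> (\<Sum>g\<in>C. card {x \<in> V. g x \<noteq> 0})" by (rule card_UN_le[OF finC])
  also have "\<dots> \<le> card C * s"
    using sum_bounded_above[of C "\<lambda>g. card {x \<in> V. g x \<noteq> 0}" s] C(1) supp by auto
  finally have cover: "card (V - B) \<le> card C * s" .
  \<comment> \<open>For \<open>w\<close> outside \<open>B\<close>, every \<open>u\<close> in
    \<open>B\<close> differs from \<open>w\<close>, so \<open>off\<close> makes \<open>f w\<close>
    vanish on all of \<open>B\<close>; this covers the members of \<open>C\<close>.\<close>
  have "fun_vs.independent (f ` B \<union> C) \<and> card (f ` B \<union> C) = card B + card C"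
    using V(2) C(1) diag off
    by (intro independent_point_functions finB C finC) blast+
  moreover have "f ` B \<union> C \<subseteq> fun_vs.span M"
    using V(2) C(1) poly by blast
  ultimately have "card B + card C \<le> card M"
    using fun_vs.independent_span_bound[OF M] by metis
  then have "(card B + card C) * s \<le> card M * s" by (rule mult_le_mono1)
  then show ?thesis using cover by (simp add: algebra_simps)
qed

section \<open>Polynomial functions of bounded degree over the two-element field\<close>

definition monomial :: "'i set \<Rightarrow> ('i \<Rightarrow> 'a::comm_monoid_mult) \<Rightarrow> 'a" where
  "monomial S x = (\<Prod>i\<in>S. x i)"

text \<open>Exponents are immaterial because \<open>x * x = x\<close> in \<open>bit\<close>, so a
  monomial is given by its set of variables.\<close>

definition monomials :: "nat \<Rightarrow> nat \<Rightarrow> ((nat \<Rightarrow> bit) \<Rightarrow> bit) set" where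
  "monomials r k = monomial ` {S. S \<subseteq> {..<r} \<and> card S \<le> k}"

lemma finite_monomials: "finite (monomials r k)"
  by (simp add: monomials_def)

lemma card_monomials_le: "card (monomials r k) \<le> (\<Sum>j=0..k. r choose j)"
proof -
  have "{S. S \<subseteq> {..<r} \<and> card S \<le> k} = (\<Union>j\<in>{0..k}. {S. S \<subseteq> {..<r} \<and> card S = j})" by auto
  then have "card {S. S \<subseteq> {..<r} \<and> card S \<le> k}
      \<le> (\<Sum>j=0..k. card {S. S \<subseteq> {..<r} \<and> card S = j})"
    by (simp add: card_UN_le)
  also have "\<dots> = (\<Sum>j=0..k. r choose j)" by (simp add: n_subsets)
  finally show ?thesis
    unfolding monomials_def
    by (rule order_trans[OF card_image_le, rotated]) simp
qed

lemma bit_mult_self: "x * x = (x::bit)"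
  by (cases x) simp_all

lemma bit_add_self: "x + x = (0::bit)"
  by (cases x) (simp_all add: add_bit_eq_xor)

text \<open>Idempotence absorbs a repeated variable, so the product is again multilinear, with at
  most one more variable.\<close>

lemma monomial_mult_coord:
  assumes "finite S"
  shows "x i * monomial S x = monomial (insert i S) (x :: nat \<Rightarrow> bit)"
proof (cases "i \<in> S")
  case True
  then have "monomial S x = x i * monomial (S - {i}) x"
    using assms by (simp add: monomial_def prod.remove)
  then show ?thesis using True by (simp add: insert_absorb bit_mult_self mult.assoc[symmetric])
qed (simp add: assms monomial_def)

text \<open>By linearity in \<open>f\<close> it suffices to multiply a single monomial, where each
  term of the affine functional adds at most one variable.\<close>

lemma affine_mult_in_span_monomials:
  assumes "f \<in> fun_vs.span (monomials r k)"
  shows "(\<lambda>x. (c + (\<Sum>i<r. a i * x i)) * f x) \<in> fun_vs.span (monomials r (Suc k))"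
  using assms
proof (induction rule: fun_vs.span_induct_alt)
  case base
  show ?case using fun_vs.span_zero by (simp add: zero_fun_def)
next
  case (step s g f)
  obtain S where S: "g = monomial S" "S \<subseteq> {..<r}" "card S \<le> k"
    using step by (auto simp: monomials_def)
  have fin: "finite S" using S finite_subset by blast
  \<comment> \<open>The expansion of the affine functional times \<open>monomial S\<close>.\<close>
  let ?m = "fun_scale c (monomial S) + (\<Sum>i<r. fun_scale (a i) (monomial (insert i S)))"
  have sum_app: "(\<Sum>i<n. h i) x = (\<Sum>i<n. h i x)" for n x and h :: "nat \<Rightarrow> (nat \<Rightarrow> bit) \<Rightarrow> bit"
    by (induction n) simp_all
  have "monomial (insert i S) \<in> monomials r (Suc k)" if "i < r" for i
    using S that fin by (auto simp: monomials_def card_insert_if)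
  moreover have "monomial S \<in> monomials r (Suc k)" using S by (auto simp: monomials_def)
  ultimately have m: "?m \<in> fun_vs.span (monomials r (Suc k))"
    by (intro fun_vs.span_add fun_vs.span_sum fun_vs.span_scale fun_vs.span_base) auto
  have "(\<lambda>x. (c + (\<Sum>i<r. a i * x i)) * (fun_scale s g + f) x)
      = fun_scale s ?m + (\<lambda>x. (c + (\<Sum>i<r. a i * x i)) * f x)"
    by (simp add: fun_eq_iff sum_app fun_scale_def S(1) algebra_simps sum_distrib_left sum.distrib
        monomial_mult_coord[OF fin, symmetric])
  then show ?case
    using fun_vs.span_add[OF fun_vs.span_scale[OF m, of s] step(2)] by metis
qed

lemma affine_product_in_span_monomials:
  assumes "finite T"
  shows "(\<lambda>x. \<Prod>t\<in>T. c t + (\<Sum>i<r. a t i * x i)) \<in> fun_vs.span (monomials r (card T))"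
  using assms
proof (induction T)
  case empty
  have "(\<lambda>x. 1) \<in> monomials r 0"
    by (auto simp: monomials_def monomial_def intro!: image_eqI[of _ _ "{}"])
  then show ?case by (simp add: fun_vs.span_base)
next
  case (insert t T)
  then show ?case using affine_mult_in_span_monomials[OF insert.IH] by simp
qed

section \<open>Sizes of subspaces and their defining equations\<close>

lemma card_span_F2:
  assumes "finite B" "F2.independent B"
  shows "finite (F2.span B) \<and> card (F2.span B) = 2 ^ card B"
  using assms
proof (induction B)
  case (insert b B)
  have indep: "F2.independent B" "b \<notin> F2.span B"
    using insert by (auto simp: F2.independent_insert)
  have IH: "finite (F2.span B)" "card (F2.span B) = 2 ^ card B"
    using insert.IH indep by auto
  have ex: "(\<exists>k::bit. P k) \<longleftrightarrow> P 0 \<or> P 1" for P by (metis bit_not_zero_iff)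
  have s: "scale_F2 1 b = b" "scale_F2 0 b = 0" by simp_all
  \<comment> \<open>With only the scalars 0 and 1, a new basis vector adds exactly one translate of
    the old span; it is disjoint from that span, so the size doubles.\<close>
  have "F2.span (insert b B) = F2.span B \<union> (\<lambda>x. x + b) ` F2.span B" (is "?l = ?r")
  proof (rule set_eqI)
    fix x
    have "x \<in> ?l \<longleftrightarrow> x \<in> F2.span B \<or> x - b \<in> F2.span B"
      by (simp only: F2.span_breakdown_eq ex s diff_zero)
    also have "x - b \<in> F2.span B \<longleftrightarrow> x \<in> (\<lambda>x. x + b) ` F2.span B"
      by (metis (no_types, lifting) add_diff_cancel diff_add_cancel image_iff)
    finally show "x \<in> ?l \<longleftrightarrow> x \<in> ?r" by blast
  qed
  moreover have "F2.span B \<inter> (\<lambda>x. x + b) ` F2.span B = {}"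
    using indep(2) F2.span_add_eq by blast
  moreover have "card ((\<lambda>x. x + b) ` F2.span B) = 2 ^ card B"
    using IH(2) by (simp add: card_image inj_on_def)
  ultimately show ?case using IH insert.hyps by (simp add: card_Un_disjoint)
qed simp

lemma card_subspace_F2:
  assumes "F2.subspace S" "finite S"
  shows "card S = 2 ^ F2.dim S"
proof -
  obtain B where B: "B \<subseteq> S" "F2.independent B" "S \<subseteq> F2.span B" "card B = F2.dim S"
    by (rule F2.basis_exists)
  then have "F2.span B = S" using assms(1) F2.span_minimal by blast
  then show ?thesis using card_span_F2[of B] B assms(2) finite_subset by metis
qed

text \<open>A basis \<open>B\<close> of \<open>L\<close> is extended to a basis \<open>E\<close> of
  the whole space. The \<open>d\<close> equations say that the coordinates at the vectors of
  \<open>E - B\<close> vanish.\<close>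

lemma codim_subspace_equations:
  assumes "codim_subspace r d L"
  shows "\<exists>(T :: (nat \<Rightarrow> bit) set) a. finite T \<and> card T = d \<and>
    (\<forall>x\<in>F2_space r. x \<in> L \<longleftrightarrow> (\<forall>t\<in>T. (\<Sum>i<r. a t i * x i) = 0))"
proof -
  have L: "L \<subseteq> F2_space r" "F2.subspace L" "F2.dim L + d = r"
    using assms by (auto simp: codim_subspace_def)
  obtain B where B: "B \<subseteq> L" "F2.independent B" "L \<subseteq> F2.span B" "card B = F2.dim L"
    by (rule F2.basis_exists)
  have spanB: "F2.span B = L" using B L(2) F2.span_minimal by blast
  obtain E where E: "B \<subseteq> E" "E \<subseteq> F2_space r" "F2.independent E" "F2_space r \<subseteq> F2.span E"
    by (rule F2.maximal_independent_subset_extend[of B "F2_space r"]) (use B L in auto)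
  have finE: "finite E" using E(2) finite_F2_space finite_subset by blast
  have "card E = r" using F2.dim_unique[OF E(2,4,3) refl] dim_F2_space by simp
  then have cardT: "card (E - B) = d"
    using E(1) finE B(4) L(3) by (simp add: card_Diff_subset finite_subset)
  define e :: "nat \<Rightarrow> nat \<Rightarrow> bit" where "e i = (\<lambda>j. if j = i then 1 else 0)" for i
  \<comment> \<open>The coordinate at \<open>t\<close> is linear, hence determined by its values on
    the unit vectors \<open>e i\<close>.\<close>
  define a where "a t i = F2.representation E (e i) t" for t i
  have e: "e i \<in> F2.span E" if "i < r" for i
    using that E(4) by (auto simp: e_def F2_space_def)
  have rep: "F2.representation E x t = (\<Sum>i<r. a t i * x i)" if x: "x \<in> F2_space r" for x t
  proof -
    have sumf: "(\<Sum>i<n. scale_F2 (x i) (e i)) j = (if j < n then x j else 0)" for n j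
      by (induction n) (auto simp: scale_F2_def e_def less_Suc_eq)
    have "x = (\<Sum>i<r. scale_F2 (x i) (e i))"
      unfolding fun_eq_iff sumf using x by (auto simp: F2_space_def)
    then have "F2.representation E x t = F2.representation E (\<Sum>i<r. scale_F2 (x i) (e i)) t"
      by simp
    also have "\<dots> = (\<Sum>i<r. F2.representation E (scale_F2 (x i) (e i)) t)"
      using e by (subst F2.representation_sum[OF E(3)]) (auto intro: F2.span_scale)
    also have "\<dots> = (\<Sum>i<r. a t i * x i)"
      using e by (intro sum.cong refl)
        (simp add: F2.representation_scale[OF E(3)] a_def mult.commute)
    finally show ?thesis .
  qed
  have "x \<in> L \<longleftrightarrow> (\<forall>t\<in>E - B. F2.representation E x t = 0)" if x: "x \<in> F2_space r" for x
  proof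
    assume "x \<in> L"
    then have "F2.representation E x = F2.representation B x"
      using F2.representation_extend[OF E(3) _ E(1)] spanB by blast
    then show "\<forall>t\<in>E - B. F2.representation E x t = 0"
      using F2.representation_ne_zero by (metis DiffD2)
  next
    assume z: "\<forall>t\<in>E - B. F2.representation E x t = 0"
    \<comment> \<open>Only vectors of \<open>B\<close> occur in the expansion of \<open>x\<close>,
      so \<open>x\<close> lies in the span of \<open>B\<close>, which is \<open>L\<close>.\<close>
    have "{b. F2.representation E x b \<noteq> 0} \<subseteq> B"
      using z F2.representation_ne_zero by blast
    then have "(\<Sum>b | F2.representation E x b \<noteq> 0. scale_F2 (F2.representation E x b) b) \<in> F2.span B"
      by (intro F2.span_sum F2.span_scale F2.span_base) blast
    then show "x \<in> L"
      using F2.sum_nonzero_representation_eq[OF E(3)] x E(4) spanB by fastforce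
  qed
  then have "\<forall>x\<in>F2_space r. x \<in> L \<longleftrightarrow> (\<forall>t\<in>E - B. (\<Sum>i<r. a t i * x i) = 0)"
    using rep by simp
  then show ?thesis using cardT finE by blast
qed

section \<open>Coset indicators as polynomials, and the bound for non-blocking sets\<close>

lemma coset_indicator_polynomial:
  assumes "codim_subspace r d L" "v \<in> F2_space r"
  shows "\<exists>f \<in> fun_vs.span (monomials r d). \<forall>x\<in>F2_space r. f x \<noteq> 0 \<longleftrightarrow> v + x \<in> L"
proof -
  obtain T :: "(nat \<Rightarrow> bit) set" and a where T: "finite T" "card T = d"
    "\<forall>x\<in>F2_space r. x \<in> L \<longleftrightarrow> (\<forall>t\<in>T. (\<Sum>i<r. a t i * x i) = 0)"
    using codim_subspace_equations[OF assms(1)] by blast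
  \<comment> \<open>The factor for \<open>t\<close> equals 1 plus the form of \<open>t\<close> at
    \<open>v + x\<close>, so it is nonzero exactly when \<open>v + x\<close> satisfies that
    equation. The part depending on \<open>v\<close> is grouped into the constant term.\<close>
  define f where "f x = (\<Prod>t\<in>T. (1 + (\<Sum>i<r. a t i * v i)) + (\<Sum>i<r. a t i * x i))" for x
  have one: "1 + y \<noteq> 0 \<longleftrightarrow> y = 0" for y :: bit
    by (cases y) (simp_all add: bit_add_self del: bit_not_zero_iff)
  have "f x \<noteq> 0 \<longleftrightarrow> v + x \<in> L" if x: "x \<in> F2_space r" for x
  proof -
    have "v + x \<in> F2_space r" using x assms(2) by (simp add: F2_space_def)
    then have "v + x \<in> L \<longleftrightarrow> (\<forall>t\<in>T. 1 + (\<Sum>i<r. a t i * (v + x) i) \<noteq> 0)"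
      using T(3) one by simp
    also have "\<dots> \<longleftrightarrow> f x \<noteq> 0"
      using T(1) by (simp add: f_def prod_zero_iff distrib_left sum.distrib add.assoc
          del: bit_not_zero_iff)
    finally show ?thesis by simp
  qed
  moreover have "f \<in> fun_vs.span (monomials r d)"
    using affine_product_in_span_monomials[OF T(1)] T(2) by (auto simp: f_def[abs_def])
  ultimately show ?thesis by blast
qed

lemma non_blocking_card_bound:
  assumes "non_blocking r d B"
  shows "card B * 2 ^ (r - d) + (2 ^ r - card B) \<le> (\<Sum>j=0..d. r choose j) * 2 ^ (r - d)"
proof -
  let ?V = "F2_space r"
  have BV: "B \<subseteq> ?V" using assms by (simp add: non_blocking_def)
  have "\<exists>L. codim_subspace r d L \<and> (\<lambda>x. v + x) ` (L - {0}) \<inter> B = {}" if "v \<in> ?V" for v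
    using that assms by (auto simp: non_blocking_def)
  then obtain L where L: "\<And>v. v \<in> ?V \<Longrightarrow> codim_subspace r d (L v)"
    "\<And>v. v \<in> ?V \<Longrightarrow> (\<lambda>x. v + x) ` (L v - {0}) \<inter> B = {}"
    by metis
  have "\<exists>f \<in> fun_vs.span (monomials r d). \<forall>x\<in>?V. f x \<noteq> 0 \<longleftrightarrow> v + x \<in> L v" if "v \<in> ?V" for v
    using coset_indicator_polynomial L(1) that by blast
  then obtain f where f: "\<And>v. v \<in> ?V \<Longrightarrow> f v \<in> fun_vs.span (monomials r d)"
    "\<And>v x. v \<in> ?V \<Longrightarrow> x \<in> ?V \<Longrightarrow> f v x \<noteq> 0 \<longleftrightarrow> v + x \<in> L v"
    by metis
  \<comment> \<open>Every vector is its own negative, so \<open>v + x \<in> L v\<close> means that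
    \<open>x\<close> lies in the coset of \<open>L v\<close> through \<open>v\<close>.\<close>
  have add_self: "x + x = 0" for x :: "nat \<Rightarrow> bit"
    by (simp add: fun_eq_iff bit_add_self)
  have cancel: "x + (x + y) = y" for x y :: "nat \<Rightarrow> bit"
    by (simp add: add.assoc[symmetric] add_self)
  have "card B * 2 ^ (r - d) + card (?V - B) \<le> card (monomials r d) * 2 ^ (r - d)"
  proof (rule local_functions_bound[of ?V B "monomials r d" f])
    show "f v v \<noteq> 0" if "v \<in> ?V" for v
    proof -
      have "0 \<in> L v" using L(1)[OF that] F2.subspace_0 by (auto simp: codim_subspace_def)
      then show ?thesis using f(2)[OF that that] add_self by metis
    qed
    show "f v u = 0" if "v \<in> ?V" "u \<in> B" "u \<noteq> v" for v u
    proof (rule ccontr)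
      \<comment> \<open>Then \<open>u = v + (v + u)\<close> is a point of \<open>B\<close> in the
        punctured coset, contrary to the choice of \<open>L v\<close>.\<close>
      assume "f v u \<noteq> 0"
      then have "v + u \<in> L v" using f(2) that BV by blast
      moreover have "v + u \<noteq> 0" using that(3) cancel by (metis add.right_neutral)
      ultimately have "v + (v + u) \<in> (\<lambda>x. v + x) ` (L v - {0})" by blast
      then show False using L(2)[OF that(1)] that(2) cancel by auto
    qed
    show "card {x \<in> ?V. f v x \<noteq> 0} \<le> 2 ^ (r - d)" if "v \<in> ?V" for v
    proof -
      have Lv: "L v \<subseteq> ?V" "F2.subspace (L v)" "F2.dim (L v) + d = r"
        using L(1)[OF that] by (auto simp: codim_subspace_def)
      have fin: "finite (L v)" using Lv(1) finite_F2_space finite_subset by blast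
      \<comment> \<open>The support of \<open>f v\<close> lies in a translate of \<open>L v\<close>,
        which has \<open>2 ^ (r - d)\<close> elements.\<close>
      have "x \<in> (\<lambda>y. v + y) ` L v" if "x \<in> {x \<in> ?V. f v x \<noteq> 0}" for x
        using f(2)[of v x] \<open>v \<in> ?V\<close> that cancel[of v x] by (metis (mono_tags, lifting) image_eqI mem_Collect_eq)
      then have "card {x \<in> ?V. f v x \<noteq> 0} \<le> card ((\<lambda>y. v + y) ` L v)"
        using fin by (intro card_mono) auto
      also have "\<dots> \<le> card (L v)" by (rule card_image_le[OF fin])
      also have "\<dots> = 2 ^ F2.dim (L v)" by (rule card_subspace_F2[OF Lv(2) fin])
      also have "F2.dim (L v) = r - d" using Lv(3) by simp
      finally show ?thesis .
    qed
  qed (use finite_F2_space finite_monomials BV f(1) in auto)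
  also have "\<dots> \<le> (\<Sum>j=0..d. r choose j) * 2 ^ (r - d)"
    using card_monomials_le by (rule mult_le_mono1)
  also have "card (?V - B) = 2 ^ r - card B"
    using card_subspace_F2[OF subspace_F2_space finite_F2_space] BV finite_F2_space
    by (simp add: card_Diff_subset finite_subset dim_F2_space)
  finally show ?thesis .
qed

theorem mainTheorem5:
  fixes r d :: nat
  assumes "d \<le> r"
  shows "(1 - 2 powi (int d - int r)) * real (beta r d)
           \<le> (\<Sum>j=0..d. real (r choose j)) - 2 ^ d"
proof -
  \<comment> \<open>The maximum is attained, so the bound can be applied to an extremal set.\<close>
  have "beta r d \<in> {card B |B. non_blocking r d B}"
    unfolding beta_def using finite_non_blocking_sizes non_blocking_empty[OF assms]
    by (intro Max_in) auto
  then obtain B where B: "non_blocking r d B" "beta r d = card B" by blast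
  let ?D = "\<Sum>j=0..d. real (r choose j)" and ?s = "2 ^ (r - d) :: real" and ?b = "real (beta r d)"
  \<comment> \<open>Adding \<open>card B\<close> to both sides removes the truncated subtraction
    before the passage to the reals.\<close>
  have "card B * 2 ^ (r - d) + 2 ^ r \<le> (\<Sum>j=0..d. r choose j) * 2 ^ (r - d) + card B"
    using non_blocking_card_bound[OF B(1)] by linarith
  then have "real (card B * 2 ^ (r - d) + 2 ^ r) \<le> real ((\<Sum>j=0..d. r choose j) * 2 ^ (r - d) + card B)"
    by (simp only: of_nat_le_iff)
  then have "?b * ?s + 2 ^ r \<le> ?D * ?s + ?b" by (simp add: B(2))
  moreover have "(2::real) ^ r = 2 ^ d * ?s" using assms by (simp flip: power_add)
  \<comment> \<open>Division by \<open>?s\<close> turns \<open>2 ^ r\<close> into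
    \<open>2 ^ d\<close>.\<close>
  ultimately have "?b - ?b / ?s \<le> ?D - 2 ^ d" by (simp add: field_simps)
  moreover have "2 powi (int d - int r) = 1 / ?s"
    using assms by (simp add: power_int_def power_one_over nat_diff_distrib' flip: of_nat_diff)
  ultimately show ?thesis by (simp add: algebra_simps)
qed

end
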